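(* Let $m \ge 38$ be an even integer and let $G$ be a graph with $m$ edges and no isolated vertices which does not contain $H(4,3)$ as a subgraph. Then $\rho(G) \le \rho'(m)$, with equality if and only if $G \cong S^{-}_{\frac{m+4}{2},2}$.
   Context: All graphs are simple and undirected. $\rho(G)$ denotes the spectral radius (largest adjacency eigenvalue) of $G$. $H(4,3)$ is the graph formed by a cycle of length $4$ and a triangle sharing exactly one common vertex. $\rho'(m)$ is the largest real root of $x^4 - m x^2 - (m-2)x + \frac{m}{2} - 1 = 0$. For $n\ge 3$, $S_{n,2} = K_2 \vee (n-2)K_1$, i.e. the graph on $n$ vertices obtained by joining both vertices of an edge to each of $n-2$ further independent vertices. $S^{-}_{\frac{m+4}{2},2}$ is the graph obtained from $S_{\frac{m+4}{2},2}$ (which has $m+1$ edges) by deleting one edge incident to a vertex of degree $2$; it has $m$ edges. *)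

theory Defs
  imports Complex_Main
begin

definition simple_graph :: "'a set \<Rightarrow> 'a set set \<Rightarrow> bool" where
  "simple_graph V E \<longleftrightarrow> finite V \<and> (\<forall>e\<in>E. e \<subseteq> V \<and> card e = 2)"

definition no_isolated :: "'a set \<Rightarrow> 'a set set \<Rightarrow> bool" where
  "no_isolated V E \<longleftrightarrow> (\<forall>v\<in>V. \<exists>e\<in>E. v \<in> e)"

definition adj_eigenvalue :: "'a set \<Rightarrow> 'a set set \<Rightarrow> real \<Rightarrow> bool" where
  "adj_eigenvalue V E \<mu> \<longleftrightarrow>
     (\<exists>x :: 'a \<Rightarrow> real. (\<forall>v. v \<notin> V \<longrightarrow> x v = 0) \<and> (\<exists>v\<in>V. x v \<noteq> 0) \<and>
        (\<forall>v\<in>V. (\<Sum>u\<in>V. if {u, v} \<in> E then x u else 0) = \<mu> * x v))"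

definition spectral_radius :: "'a set \<Rightarrow> 'a set set \<Rightarrow> real" where
  "spectral_radius V E = Max {\<mu>. adj_eigenvalue V E \<mu>}"

text \<open>H(4,3): 4-cycle 0-1-2-3-0 and triangle 0-4-5 sharing vertex 0.\<close>
definition H43_E :: "nat set set" where
  "H43_E = {{0,1},{1,2},{2,3},{3,0},{0,4},{4,5},{5,0}}"

definition contains_H43 :: "'a set \<Rightarrow> 'a set set \<Rightarrow> bool" where
  "contains_H43 V E \<longleftrightarrow>
     (\<exists>f :: nat \<Rightarrow> 'a. inj_on f {0..5} \<and> f ` {0..5} \<subseteq> V \<and> (\<forall>e\<in>H43_E. f ` e \<in> E))"

definition graph_iso :: "'a set \<Rightarrow> 'a set set \<Rightarrow> 'b set \<Rightarrow> 'b set set \<Rightarrow> bool" where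
  "graph_iso V E W F \<longleftrightarrow>
     (\<exists>f. bij_betw f V W \<and> (\<forall>u\<in>V. \<forall>v\<in>V. {u, v} \<in> E \<longleftrightarrow> {f u, f v} \<in> F))"

text \<open>S_{n,2} = K_2 join (n-2)K_1 on vertices {0..<n}, with the edge {0,1}.\<close>
definition S2_E :: "nat \<Rightarrow> nat set set" where
  "S2_E n = {{0,1}} \<union> {{0,i} | i. 2 \<le> i \<and> i < n} \<union> {{1,i} | i. 2 \<le> i \<and> i < n}"

text \<open>S^-_{n,2}: delete the edge {1,2}, which is incident to the degree-2 vertex 2.\<close>
definition S2minus_E :: "nat \<Rightarrow> nat set set" where
  "S2minus_E n = S2_E n - {{1,2}}"

definition rho' :: "nat \<Rightarrow> real" where
  "rho' m = Max {x::real. x^4 - real m * x^2 - (real m - 2) * x + real m / 2 - 1 = 0}"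

end

(* Let mu >= rho'(m) be an eigenvalue with eigenvector x, normalised so that |x| has maximum 1,
   attained at z. Put U = N(z), W = V - U - {z}, and let d count neighbours in U. Evaluating
   A^2 - A at z, and using mu^2 - mu > m - 3/2, gives
     sum_U (d(u) - 1)|x_u| + 3/2 > e(U) + e(W) + sum_W d(w)(1 - |x_w|).
   Since mu <= sum_U |x_u|, this forces e(U) > 5. Freeness of H(4,3) means that G[U] contains no
   path on 3 vertices together with a disjoint edge, so the nontrivial part of G[U] is a K_4, which
   the inequality rules out, or a star, for which it forces W to be empty. If t vertices of U are
   isolated in G[U], then t is odd and f(mu) = (t - 1)(1/2 - r - mu), where f is the quartic
   defining rho' and r the number of leaves of the star; as f >= 0 beyond rho', t = 1.

   Only A|x| >= mu |x| entrywise is used for |x|, so no Perron vector is needed, and G need not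
   be connected. *)

theory Submission
  imports Defs "Jordan_Normal_Form.Char_Poly" "HOL-Computational_Algebra.Fundamental_Theorem_Algebra"
begin

section \<open>Eigenvalues of symmetric matrices\<close>

text \<open>The form \<open>?q\<close> equals its own conjugate by symmetry, while the eigenvalue
  equation turns it into \<open>k\<close> times the nonzero squared norm of
  \<open>z\<close>.\<close>

lemma symmetric_complex_eigenvalue_real:
  fixes a :: "'a \<Rightarrow> 'a \<Rightarrow> real" and z :: "'a \<Rightarrow> complex"
  assumes "finite V" and sym: "\<And>u v. a u v = a v u"
    and ev: "\<And>v. v \<in> V \<Longrightarrow> (\<Sum>u\<in>V. of_real (a u v) * z u) = k * z v"
    and nz: "\<exists>v\<in>V. z v \<noteq> 0"
  shows "k \<in> \<real>"
proof -
  let ?q = "\<Sum>v\<in>V. \<Sum>u\<in>V. of_real (a u v) * (cnj (z v) * z u)"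
  have "cnj ?q = (\<Sum>v\<in>V. \<Sum>u\<in>V. of_real (a u v) * (z v * cnj (z u)))"
    by simp
  also have "\<dots> = (\<Sum>u\<in>V. \<Sum>v\<in>V. of_real (a u v) * (z v * cnj (z u)))"
    by (rule sum.swap)
  also have "\<dots> = ?q"
    by (intro sum.cong refl) (simp add: sym ac_simps)
  finally have q: "?q \<in> \<real>"
    by (simp add: Reals_cnj_iff)
  have "?q = (\<Sum>v\<in>V. cnj (z v) * (\<Sum>u\<in>V. of_real (a u v) * z u))"
    by (simp add: sum_distrib_left mult_ac)
  also have "\<dots> = (\<Sum>v\<in>V. cnj (z v) * (k * z v))"
    by (intro sum.cong refl) (simp add: ev)
  also have "\<dots> = (\<Sum>v\<in>V. k * of_real ((cmod (z v))\<^sup>2))"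
    by (intro sum.cong refl) (simp add: complex_norm_square mult_ac del: of_real_power)
  also have "\<dots> = k * of_real (\<Sum>v\<in>V. (cmod (z v))\<^sup>2)"
    by (simp add: sum_distrib_left)
  finally have eq: "?q = k * of_real (\<Sum>v\<in>V. (cmod (z v))\<^sup>2)" .
  have "(\<Sum>v\<in>V. (cmod (z v))\<^sup>2) \<noteq> 0"
    using nz \<open>finite V\<close> by (subst sum_nonneg_eq_0_iff) auto
  then have "k = ?q / of_real (\<Sum>v\<in>V. (cmod (z v))\<^sup>2)"
    unfolding eq by (simp del: of_real_sum)
  moreover have "?q / of_real (\<Sum>v\<in>V. (cmod (z v))\<^sup>2) \<in> \<real>"
    using q by (intro Reals_divide Reals_of_real)
  ultimately show ?thesis
    by (rule ssubst)
qed

text \<open>This gives meaning to the \<open>Max\<close> in \<open>spectral_radius\<close>.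
  Finiteness comes from the roots of the characteristic polynomial; existence comes from a complex
  root, which symmetry forces to be real.\<close>

lemma symmetric_eigenvalues:
  fixes a :: "'a \<Rightarrow> 'a \<Rightarrow> real"
  assumes "finite V" and "V \<noteq> {}" and sym: "\<And>u v. a u v = a v u"
  defines "ev \<equiv> \<lambda>\<mu>. \<exists>x. (\<forall>v. v \<notin> V \<longrightarrow> x v = 0) \<and> (\<exists>v\<in>V. x v \<noteq> 0) \<and>
     (\<forall>v\<in>V. (\<Sum>u\<in>V. a u v * x u) = \<mu> * x v)"
  shows "finite {\<mu>. ev \<mu>}" and "{\<mu>. ev \<mu>} \<noteq> {}"
proof -
  define n where "n = card V"
  have n: "n > 0"
    using assms by (simp add: n_def card_gt_0_iff)
  obtain h where h: "bij_betw h {0..<n} V"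
    using ex_bij_betw_nat_finite[OF \<open>finite V\<close>] n_def by blast
  \<comment> \<open>The indices of \<open>a\<close> are swapped so that row \<open>i\<close> sums
    \<open>a u (h i) * z u\<close> over \<open>u\<close>, as in \<open>ev\<close>.\<close>
  define A where "A = mat n n (\<lambda>(i, j). complex_of_real (a (h j) (h i)))"
  have A: "A \<in> carrier_mat n n"
    by (simp add: A_def)
  have fin: "finite {k. eigenvalue A k}"
  proof -
    have "char_poly A \<noteq> 0"
      using degree_monic_char_poly[OF A] by auto
    then show ?thesis
      unfolding eigenvalue_root_char_poly[OF A] by (rule poly_roots_finite)
  qed
  have mult: "(A *\<^sub>v vec n (\<lambda>i. z (h i))) $ i = (\<Sum>u\<in>V. of_real (a u (h i)) * z u)"
    if "i < n" for z i
  proof -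
    have "(A *\<^sub>v vec n (\<lambda>i. z (h i))) $ i = (\<Sum>j\<in>{0..<n}. of_real (a (h j) (h i)) * z (h j))"
      using that by (simp add: A_def scalar_prod_def)
    also have "\<dots> = (\<Sum>u\<in>V. of_real (a u (h i)) * z u)"
      by (rule sum.reindex_bij_betw[OF h])
    finally show ?thesis .
  qed
  have sub: "eigenvalue A (of_real \<mu>)" if evm: "ev \<mu>" for \<mu>
  proof -
    obtain x where x: "\<exists>v\<in>V. x v \<noteq> 0" "\<And>v. v \<in> V \<Longrightarrow> (\<Sum>u\<in>V. a u v * x u) = \<mu> * x v"
      using evm unfolding ev_def by blast
    let ?v = "vec n (\<lambda>i. complex_of_real (x (h i)))"
    have "?v \<noteq> 0\<^sub>v n"
    proof
      assume 0: "?v = 0\<^sub>v n"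
      obtain i where "i < n" "x (h i) \<noteq> 0"
        using x(1) h by (auto simp: bij_betw_def)
      then show False
        using arg_cong[OF 0, of "\<lambda>v. v $ i"] by simp
    qed
    moreover have "A *\<^sub>v ?v = of_real \<mu> \<cdot>\<^sub>v ?v"
    proof (rule eq_vecI)
      fix i assume "i < dim_vec (of_real \<mu> \<cdot>\<^sub>v ?v)"
      then have i: "i < n" by simp
      then have "h i \<in> V"
        using h by (auto simp: bij_betw_def)
      then have "complex_of_real (\<Sum>u\<in>V. a u (h i) * x u) = of_real (\<mu> * x (h i))"
        using x(2) by metis
      then show "(A *\<^sub>v ?v) $ i = (of_real \<mu> \<cdot>\<^sub>v ?v) $ i"
        using i by (subst mult[of i "\<lambda>u. of_real (x u)"]) simp_all
    qed (use A in simp)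
    ultimately show ?thesis
      using A unfolding eigenvalue_def eigenvector_def by (metis carrier_matD(1) vec_carrier)
  qed
  show "finite {\<mu>. ev \<mu>}"
    by (rule finite_subset[OF _ finite_vimageI[OF fin inj_of_real]]) (use sub in auto)
  have "degree (char_poly A) \<noteq> 0"
    using degree_monic_char_poly[OF A] n by simp
  then have "\<not> constant (poly (char_poly A))"
    by (simp add: constant_degree)
  then obtain k where "eigenvalue A k"
    using fundamental_theorem_of_algebra eigenvalue_root_char_poly[OF A] by blast
  then obtain v where v: "v \<in> carrier_vec n" "v \<noteq> 0\<^sub>v n" "A *\<^sub>v v = k \<cdot>\<^sub>v v"
    unfolding eigenvalue_def eigenvector_def using A by auto
  define g where "g = the_inv_into {0..<n} h"
  define z where "z u = (if u \<in> V then v $ g u else 0)" for u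
  have zh: "z (h i) = v $ i" if "i < n" for i
    using that h the_inv_into_f_f[of h "{0..<n}" i]
    by (auto simp: z_def g_def bij_betw_def)
  have vz: "vec n (\<lambda>i. z (h i)) = v"
    using v(1) by (intro eq_vecI) (auto simp: zh)
  have zev: "(\<Sum>u\<in>V. of_real (a u w) * z u) = k * z w" if "w \<in> V" for w
  proof -
    obtain i where i: "i < n" "h i = w"
      using \<open>w \<in> V\<close> h by (auto simp: bij_betw_def)
    have "(\<Sum>u\<in>V. of_real (a u w) * z u) = (A *\<^sub>v v) $ i"
      using mult[OF i(1), of z] i(2) vz by simp
    then show ?thesis
      using v i zh by auto
  qed
  have "\<exists>i<n. v $ i \<noteq> 0"
  proof (rule ccontr)
    assume "\<not> (\<exists>i<n. v $ i \<noteq> 0)"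
    then have "v = 0\<^sub>v n"
      using v(1) by (intro eq_vecI) auto
    with v(2) show False ..
  qed
  then have znz: "\<exists>w\<in>V. z w \<noteq> 0"
    using h zh by (force simp: bij_betw_def)
  obtain \<mu> where k: "k = of_real \<mu>"
    using symmetric_complex_eigenvalue_real[OF \<open>finite V\<close> sym zev znz] by (auto elim: Reals_cases)
  \<comment> \<open>With \<open>a\<close> and \<open>\<mu>\<close> real, the real and imaginary
    parts of \<open>z\<close> solve the same equations, and at least one of them is nonzero.\<close>
  have "(\<Sum>u\<in>V. a u w * Re (z u)) = \<mu> * Re (z w)" "(\<Sum>u\<in>V. a u w * Im (z u)) = \<mu> * Im (z w)"
    if "w \<in> V" for w
    using arg_cong[OF zev[OF that], of Re] arg_cong[OF zev[OF that], of Im] by (simp_all add: k)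
  moreover have "(\<exists>w\<in>V. Re (z w) \<noteq> 0) \<or> (\<exists>w\<in>V. Im (z w) \<noteq> 0)"
    using znz by (auto simp: complex_eq_iff)
  moreover have "z u = 0" if "u \<notin> V" for u
    using that by (simp add: z_def)
  ultimately have "ev \<mu>"
    unfolding ev_def
    by (elim disjE; intro exI[of _ "\<lambda>u. Re (z u)"] exI[of _ "\<lambda>u. Im (z u)"]) auto
  then show "{\<mu>. ev \<mu>} \<noteq> {}"
    by blast
qed

lemma adj_eigenvalues:
  assumes "finite V" and "V \<noteq> {}"
  shows "finite {\<mu>. adj_eigenvalue V E \<mu>}" and "{\<mu>. adj_eigenvalue V E \<mu>} \<noteq> {}"
proof -
  have eq: "(\<Sum>u\<in>V. if {u, v} \<in> E then x u else 0) = (\<Sum>u\<in>V. of_bool ({u, v} \<in> E) * x u)"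
    for x :: "'a \<Rightarrow> real" and v
    by (intro sum.cong) auto
  have sym: "(of_bool ({u, v} \<in> E) :: real) = of_bool ({v, u} \<in> E)" for u v
    by (simp add: insert_commute)
  show "finite {\<mu>. adj_eigenvalue V E \<mu>}" and "{\<mu>. adj_eigenvalue V E \<mu>} \<noteq> {}"
    unfolding adj_eigenvalue_def eq
    using symmetric_eigenvalues[OF assms, of "\<lambda>u v. of_bool ({u, v} \<in> E)", OF sym] by simp_all
qed

section \<open>The quartic\<close>

definition quartic :: "nat \<Rightarrow> real \<Rightarrow> real" where
  "quartic m x = x^4 - real m * x^2 - (real m - 2) * x + real m / 2 - 1"

text \<open>The quartic is nonnegative far to the right, so by the intermediate value theorem every
  point with a negative value has a root beyond it. The point 1 is such a point, hence roots
  exist.\<close>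

lemma rho'_root:
  assumes "m \<ge> 2"
  shows "quartic m (rho' m) = 0"
    and "x \<ge> rho' m \<Longrightarrow> quartic m x \<ge> 0"
    and "quartic m x < 0 \<Longrightarrow> x < rho' m"
    and "quartic m x = 0 \<Longrightarrow> x \<le> rho' m"
proof -
  let ?R = "{x. quartic m x = 0}"
  have rho: "rho' m = Max ?R"
    by (simp add: rho'_def quartic_def)
  let ?p = "[:real m / 2 - 1, - (real m - 2), - real m, 0, 1:]"
  have "poly ?p x = quartic m x" for x
    by (simp add: quartic_def algebra_simps power4_eq_xxxx power2_eq_square)
  then have fin: "finite ?R"
    using poly_roots_finite[of ?p] by simp
  have cont: "continuous_on A (quartic m)" for A
    unfolding quartic_def by (intro continuous_intros)
  have above: "\<exists>y>x. quartic m y = 0" if "quartic m x < 0" for x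
  proof -
    define b where "b = max x (real m + 1)"
    have b: "b \<ge> m + 1" "b \<ge> 1" "b \<ge> x" by (auto simp: b_def)
    \<comment> \<open>Grouped so that each of the three summands is visibly nonnegative once
      \<open>b \<ge> m + 1\<close>.\<close>
    have "quartic m b = b\<^sup>2 * (b\<^sup>2 - 2 * real m) + b * (real m * (b - 1) + 2) + (real m / 2 - 1)"
      by (simp add: quartic_def algebra_simps power2_eq_square power4_eq_xxxx)
    moreover have "(real m + 1)\<^sup>2 \<le> b\<^sup>2"
      using b by (intro power_mono) auto
    then have "2 * real m \<le> b\<^sup>2"
      unfolding power2_sum one_power2 using zero_le_power2[of "real m"] by linarith
    then have "b\<^sup>2 * (b\<^sup>2 - 2 * real m) \<ge> 0"
      by simp
    moreover have "b * (real m * (b - 1) + 2) \<ge> 0"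
      using b by (intro mult_nonneg_nonneg add_nonneg_nonneg) auto
    ultimately have "quartic m b \<ge> 0"
      using assms by simp
    moreover have "quartic m x \<le> 0"
      using that by simp
    ultimately obtain y where "y \<ge> x" "quartic m y = 0"
      using IVT'[of "quartic m" x 0 b] cont b(3) by blast
    then show ?thesis
      using that by (metis less_irrefl order_le_less)
  qed
  have "quartic m 1 < 0"
    using assms by (simp add: quartic_def)
  then have "?R \<noteq> {}"
    using above by blast
  then show root: "quartic m (rho' m) = 0"
    using Max_in[OF fin] rho by auto
  show "quartic m x = 0 \<Longrightarrow> x \<le> rho' m"
    using Max_ge[OF fin] rho by simp
  have lt: "x < rho' m" if "quartic m x < 0" for x
    using above[OF that] Max_ge[OF fin] rho by fastforce
  then show "quartic m x < 0 \<Longrightarrow> x < rho' m" .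
  then show "x \<ge> rho' m \<Longrightarrow> quartic m x \<ge> 0"
    by (metis not_le)
qed

text \<open>The positive solution \<open>p\<close> of \<open>p\<^sup>2 - p = m - 3/2\<close> gives
  the quartic the value -1/4, so it lies below \<open>rho' m\<close>; beyond \<open>p\<close> the
  function \<open>x\<^sup>2 - x\<close> increases.\<close>

lemma rho'_lower:
  assumes "m \<ge> 38" and "x \<ge> rho' m"
  shows "x > 13/2" and "x\<^sup>2 - x > m - 3/2"
proof -
  define p where "p = (1 + sqrt (4 * real m - 5)) / 2"
  have p: "p\<^sup>2 = p + m - 3/2"
    using assms(1) unfolding p_def by (simp add: power2_eq_square field_simps)
  have "quartic m p = (p\<^sup>2 + p) * (p\<^sup>2 - p - m + 1) + p + m / 2 - 1"
    by (simp add: quartic_def algebra_simps power2_eq_square power4_eq_xxxx)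
  then have "quartic m p = -1/4"
    unfolding p by (simp add: field_simps)
  then have px: "p < x"
    using rho'_root(3)[of m p] assms by simp
  \<comment> \<open>Here \<open>m \<ge> 38\<close> enters: \<open>4 * 38 - 5 = 147\<close> is at
    least 144, and \<open>(1 + 12) / 2 = 13/2\<close>.\<close>
  have "12 \<le> sqrt (4 * real m - 5)"
    by (rule real_le_rsqrt) (use assms in simp)
  then have "p \<ge> 13/2"
    by (simp add: p_def)
  then show "x > 13/2"
    using px by simp
  have "(x - p) * (x + p - 1) > 0"
    using px \<open>p \<ge> 13/2\<close> by (intro mult_pos_pos) auto
  then show "x\<^sup>2 - x > m - 3/2"
    using p by (simp add: power2_eq_square algebra_simps)
qed

section \<open>The neighbourhood of a maximal entry\<close>

lemma sum_degrees:
  assumes "simple_graph V E"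
  shows "(\<Sum>v\<in>V. card {u\<in>V. {u, v} \<in> E}) = 2 * card E"
proof -
  have V: "finite V" and e: "\<And>e. e \<in> E \<Longrightarrow> e \<subseteq> V \<and> card e = 2"
    using assms by (auto simp: simple_graph_def)
  have E: "finite E"
    using V e by (intro finite_subset[of E "Pow V"]) auto
  have "card {u\<in>V. {u, v} \<in> E} = card {e\<in>E. v \<in> e}" if "v \<in> V" for v
  proof (rule bij_betw_same_card[of "\<lambda>u. {u, v}"], unfold bij_betw_def, intro conjI equalityI subsetI)
    show "inj_on (\<lambda>u. {u, v}) {u\<in>V. {u, v} \<in> E}"
      by (auto simp: inj_on_def doubleton_eq_iff)
  next
    fix e' assume "e' \<in> {e\<in>E. v \<in> e}"
    then have e': "e' \<in> E" "v \<in> e'" "e' \<subseteq> V" "card e' = 2"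
      using e by auto
    then obtain p q where "e' = {p, q}"
      by (auto simp: card_2_iff)
    with e' show "e' \<in> (\<lambda>u. {u, v}) ` {u\<in>V. {u, v} \<in> E}"
      by (auto simp: insert_commute image_iff)
  qed auto
  then have "(\<Sum>v\<in>V. card {u\<in>V. {u, v} \<in> E}) = (\<Sum>v\<in>V. card {e\<in>E. v \<in> e})"
    by simp
  also have "\<dots> = (\<Sum>e\<in>E. 2)"
  proof (rule sum_multicount_gen[OF V E], intro ballI)
    fix e' assume "e' \<in> E"
    then have "{i\<in>V. i \<in> e'} = e'" "card e' = 2"
      using e by auto
    then show "card {i\<in>V. i \<in> e'} = 2" by simp
  qed
  finally show ?thesis by simp
qed

text \<open>\<open>a\<close> is the shared vertex, \<open>b\<close>, \<open>c\<close>,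
  \<open>d\<close> complete the 4-cycle and \<open>p\<close>, \<open>q\<close> the triangle.\<close>

lemma contains_H43I:
  assumes "simple_graph V E" and "distinct [a, b, c, d, p, q]"
    and "{a, b} \<in> E" "{b, c} \<in> E" "{c, d} \<in> E" "{d, a} \<in> E" "{a, p} \<in> E" "{p, q} \<in> E" "{q, a} \<in> E"
  shows "contains_H43 V E"
proof -
  let ?f = "\<lambda>i::nat. [a, b, c, d, p, q] ! i"
  have I: "{0..5::nat} = {0, 1, 2, 3, 4, 5}" by auto
  have "inj_on ?f {0..5}"
    by (rule inj_on_nth) (use assms(2) in auto)
  moreover have "?f ` {0..5} \<subseteq> V"
    using assms unfolding I simple_graph_def by auto
  moreover have "\<forall>e\<in>H43_E. ?f ` e \<in> E"
    using assms by (simp add: H43_E_def)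
  ultimately show ?thesis
    unfolding contains_H43_def by blast
qed

lemma two_le_cardE:
  assumes "2 \<le> card A"
  obtains s t where "s \<in> A" "t \<in> A" "s \<noteq> t"
proof -
  obtain B where "B \<subseteq> A" "card B = 2"
    using obtain_subset_with_card_n[OF assms] by blast
  then show ?thesis
    using that by (auto simp: card_2_iff)
qed

text \<open>\<open>y\<close> stands for the normalised absolute values of an eigenvector with
  maximal entry at \<open>z\<close>. Taking absolute values preserves only the inequality
  \<open>sub\<close>. The two numerical bounds are those of \<open>rho'_lower\<close>.\<close>

locale subeigenvector =
  fixes V :: "'a set" and E :: "'a set set" and \<mu> :: real and y :: "'a \<Rightarrow> real" and z :: 'a
  assumes graph: "simple_graph V E"
    and zV: "z \<in> V" and yz: "y z = 1"
    and y0: "\<And>v. v \<in> V \<Longrightarrow> 0 \<le> y v" and y1: "\<And>v. v \<in> V \<Longrightarrow> y v \<le> 1"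
    and sub: "\<And>v. v \<in> V \<Longrightarrow> \<mu> * y v \<le> (\<Sum>u\<in>V. of_bool ({u, v} \<in> E) * y u)"
    and mu: "\<mu> > 13/2" and large: "\<mu>\<^sup>2 - \<mu> > card E - 3/2"
begin

abbreviation adj where "adj u v \<equiv> {u, v} \<in> E"
definition "U = {u\<in>V. adj u z}"
definition "W = V - U - {z}"
definition d :: "'a \<Rightarrow> nat" where "d v = card {u\<in>U. adj u v}"

lemma adj_commute: "adj u v \<longleftrightarrow> adj v u"
  by (simp add: insert_commute)

lemma adj_irrefl: "\<not> adj u u"
  using graph by (auto simp: simple_graph_def)

lemma adj_V: "adj u v \<Longrightarrow> u \<in> V \<and> v \<in> V"
  using graph by (auto simp: simple_graph_def)

lemma finV: "finite V" and finU: "finite U" and finW: "finite W"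
  using graph by (auto simp: simple_graph_def U_def W_def)

lemma zU: "z \<notin> U" and UV: "U \<subseteq> V" and WV: "W \<subseteq> V"
  by (auto simp: U_def W_def adj_irrefl[simplified])

lemma W_z: "w \<in> W \<Longrightarrow> \<not> adj w z"
  by (auto simp: W_def U_def)

lemma sum_V: "(\<Sum>v\<in>V. f v) = f z + (\<Sum>v\<in>U. f v) + (\<Sum>v\<in>W. f v)" for f :: "'a \<Rightarrow> real"
proof -
  have V: "V = insert z (U \<union> W)" and "z \<notin> U \<union> W" and "U \<inter> W = {}"
    using zU zV UV by (auto simp: W_def)
  have "sum f V = sum f (insert z (U \<union> W))"
    by (rule arg_cong[OF V])
  also have "\<dots> = f z + sum f U + sum f W"
    using finU finW \<open>z \<notin> U \<union> W\<close> \<open>U \<inter> W = {}\<close> by (simp add: sum.union_disjoint add.assoc)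
  finally show ?thesis .
qed

lemma d_sum: "real (d v) = (\<Sum>u\<in>U. of_bool (adj u v))"
  using finU by (simp add: d_def Int_def conj_commute)

lemma d_sum': "real (d v) = (\<Sum>u\<in>U. of_bool (adj v u))"
  by (simp add: d_sum adj_commute)

lemma d_W: "(\<Sum>v\<in>U. \<Sum>w\<in>W. of_bool (adj w v) * f w) = (\<Sum>w\<in>W. d w * f w)" for f :: "'a \<Rightarrow> real"
  by (subst sum.swap) (simp add: d_sum' sum_distrib_right)

text \<open>This is \<open>sub\<close> at \<open>z\<close>, whose neighbours are exactly
  \<open>U\<close> and whose weight is 1.\<close>

lemma mu_le: "\<mu> \<le> (\<Sum>u\<in>U. y u)"
proof -
  have "(\<Sum>u\<in>U. of_bool (adj u z) * y u) = (\<Sum>u\<in>U. y u)"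
    by (intro sum.cong) (auto simp: U_def)
  moreover have "(\<Sum>u\<in>W. of_bool (adj u z) * y u) = 0"
    using W_z by (intro sum.neutral) auto
  ultimately show ?thesis
    using sub[OF zV] yz adj_irrefl[of z] by (simp add: sum_V)
qed

text \<open>The handshake identity split along \<open>{z}\<close>, \<open>U\<close> and
  \<open>W\<close>. Edges inside \<open>U\<close> or inside \<open>W\<close> are counted from both
  ends, hence the halves.\<close>

lemma edge_count:
  "real (card E) = card U + (\<Sum>u\<in>U. real (d u)) / 2 + (\<Sum>w\<in>W. real (d w))
     + (\<Sum>w\<in>W. \<Sum>w'\<in>W. of_bool (adj w' w)) / 2"
proof -
  let ?a = "\<lambda>u v. of_bool (adj u v) :: real"
  have "2 * real (card E) = (\<Sum>v\<in>V. \<Sum>u\<in>V. ?a u v)"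
    using finV arg_cong[OF sum_degrees[OF graph], of real] by (simp add: Int_def conj_commute)
  moreover have "(\<Sum>u\<in>U. ?a u z) = card U" "(\<Sum>u\<in>U. ?a z u) = card U"
    by (simp_all add: U_def insert_commute)
  moreover have "(\<Sum>u\<in>W. ?a u z) = 0" "(\<Sum>u\<in>W. ?a z u) = 0"
    using W_z by (auto simp: insert_commute intro!: sum.neutral)
  moreover have "(\<Sum>u\<in>U. \<Sum>w\<in>W. ?a w u) = (\<Sum>w\<in>W. real (d w))"
    using d_W[of "\<lambda>_. 1"] by simp
  ultimately show ?thesis
    using adj_irrefl[of z] by (simp add: sum_V sum.distrib flip: d_sum)
qed

text \<open>Summing \<open>sub\<close> over \<open>U\<close> bounds \<open>\<mu> * ?s\<close> by
  weighted walks of length two from \<open>z\<close>. Subtracting \<open>?s\<close> and comparing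
  with \<open>\<mu>\<^sup>2 - \<mu> > card E - 3/2\<close> cancels the \<open>card U\<close> edges
  at \<open>z\<close>.\<close>

lemma key:
  "(\<Sum>u\<in>U. d u * y u) - (\<Sum>u\<in>U. y u) + 3/2
     > (\<Sum>u\<in>U. real (d u)) / 2 + (\<Sum>w\<in>W. \<Sum>w'\<in>W. of_bool (adj w' w)) / 2 + (\<Sum>w\<in>W. d w * (1 - y w))"
proof -
  let ?s = "\<Sum>u\<in>U. y u"
  have "\<mu> * ?s \<le> (\<Sum>v\<in>U. \<Sum>u\<in>V. of_bool (adj u v) * y u)"
    unfolding sum_distrib_left using UV by (intro sum_mono sub) auto
  also have "\<dots> = (\<Sum>v\<in>U. of_bool (adj z v)) + (\<Sum>v\<in>U. \<Sum>u\<in>U. of_bool (adj u v) * y u)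
      + (\<Sum>v\<in>U. \<Sum>w\<in>W. of_bool (adj w v) * y w)"
    by (simp add: sum_V sum.distrib yz)
  also have "(\<Sum>v\<in>U. of_bool (adj z v)) = real (card U)"
    by (simp add: U_def insert_commute)
  also have "(\<Sum>v\<in>U. \<Sum>u\<in>U. of_bool (adj u v) * y u) = (\<Sum>u\<in>U. d u * y u)"
    by (subst sum.swap) (simp add: d_sum' sum_distrib_right)
  finally have "\<mu> * ?s \<le> card U + (\<Sum>u\<in>U. d u * y u) + (\<Sum>w\<in>W. d w * y w)"
    unfolding d_W .
  moreover have "(\<mu> - 1) * \<mu> \<le> (\<mu> - 1) * ?s"
    using mu mu_le by (intro mult_left_mono) auto
  ultimately show ?thesis
    using large edge_count by (simp add: power2_eq_square algebra_simps sum_subtractf)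
qed

text \<open>All neighbours of \<open>w\<close> lie in \<open>U\<close> and weigh at most 1. Since
  \<open>\<mu>\<close> is large, \<open>y w\<close> is small and the loss
  \<open>d w * (1 - y w)\<close> in \<open>key\<close> is close to \<open>d w\<close>.\<close>

lemma W_y:
  assumes "\<And>w w'. w \<in> W \<Longrightarrow> w' \<in> W \<Longrightarrow> \<not> adj w w'" and w: "w \<in> W"
  shows "\<mu> * y w \<le> d w"
proof -
  have "(\<Sum>u\<in>W. of_bool (adj u w) * y u) = 0"
    using assms by (intro sum.neutral) auto
  moreover have "(\<Sum>u\<in>U. of_bool (adj u w) * y u) \<le> (\<Sum>u\<in>U. of_bool (adj u w))"
    using y1 UV by (intro sum_mono) auto
  moreover have "\<not> adj z w"
    using W_z[OF w] by (simp add: insert_commute)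
  ultimately show ?thesis
    using sub[of w] w WV by (simp add: sum_V d_sum subset_iff)
qed

text \<open>An edge inside \<open>W\<close> contributes 1 for each of its two orientations.\<close>

lemma W_indep:
  assumes "(\<Sum>w\<in>W. \<Sum>w'\<in>W. of_bool (adj w' w)) < (2::real)" and "w \<in> W" "w' \<in> W"
  shows "\<not> adj w w'"
proof
  assume a: "adj w w'"
  then have ne: "w \<noteq> w'"
    using adj_irrefl by auto
  have "(2::real) = (\<Sum>p\<in>{(w, w'), (w', w)}. of_bool (adj (snd p) (fst p)))"
    using ne a by (simp add: insert_commute)
  also have "\<dots> \<le> (\<Sum>p\<in>W\<times>W. of_bool (adj (snd p) (fst p)))"
    using finW assms by (intro sum_mono2) auto
  also have "\<dots> = (\<Sum>w\<in>W. \<Sum>w'\<in>W. of_bool (adj w' w))"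
    by (simp add: sum.cartesian_product case_prod_beta)
  finally show False
    using assms(1) by simp
qed

end

section \<open>The structure of \<open>U\<close> and \<open>W\<close> when \<open>H(4,3)\<close> is
  forbidden\<close>

locale H43_free_subeigenvector = subeigenvector +
  assumes noiso: "no_isolated V E" and H43: "\<not> contains_H43 V E"
begin

text \<open>The path closes through \<open>z\<close> to the 4-cycle \<open>z p b q\<close>, and the
  edge to the triangle \<open>z r s\<close>. The midpoint \<open>b\<close> may lie in
  \<open>U\<close> or in \<open>W\<close>.\<close>

lemma no_path_edge:
  assumes "p \<in> U" "q \<in> U" "r \<in> U" "s \<in> U" "b \<noteq> z" "distinct [p, b, q, r, s]"
    and "adj p b" "adj q b" "adj r s"
  shows False
proof -
  have "contains_H43 V E"
    using assms zU
    by (intro contains_H43I[OF graph, of z p b q r s]) (auto simp: U_def insert_commute)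
  then show False
    using H43 by simp
qed

text \<open>Bounding all weights in \<open>key\<close> by 1 leaves half the degree sum above
  \<open>\<mu> - 3/2 > 5\<close>.\<close>

lemma D_gt: "(\<Sum>u\<in>U. real (d u)) > 10"
proof -
  have "(\<Sum>u\<in>U. d u * y u) \<le> (\<Sum>u\<in>U. real (d u))"
    using y1 UV by (intro sum_mono mult_left_le) auto
  moreover have "0 \<le> (\<Sum>w\<in>W. d w * (1 - y w))"
    using y1 WV by (intro sum_nonneg) auto
  moreover have "0 \<le> (\<Sum>w\<in>W. \<Sum>w'\<in>W. of_bool (adj w' w) :: real)"
    by (intro sum_nonneg) auto
  ultimately show ?thesis
    using key mu mu_le by linarith
qed

lemma D_gt_nat: "(\<Sum>u\<in>U. d u) > 10"
  using D_gt by (simp flip: of_nat_sum)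

lemma D_support:
  fixes f :: "'a \<Rightarrow> real"
  assumes "T \<subseteq> U" and "\<And>u. u \<in> U \<Longrightarrow> u \<notin> T \<Longrightarrow> d u = 0"
  shows "(\<Sum>u\<in>U. d u * f u) = (\<Sum>u\<in>T. d u * f u)"
  using assms finU by (intro sum.mono_neutral_right) auto

lemma d_eq_0: "d v = 0 \<longleftrightarrow> (\<forall>u\<in>U. \<not> adj u v)"
  unfolding d_def using finU by auto

text \<open>If \<open>G[U]\<close> were a matching, the first two sums of \<open>key\<close> would
  contribute nothing positive, leaving \<open>3/2\<close> above half the degree sum.\<close>

lemma ex_d_ge_2: "\<exists>b\<in>U. d b \<ge> 2"
proof (rule ccontr)
  assume "\<not> (\<exists>b\<in>U. d b \<ge> 2)"
  then have "(\<Sum>u\<in>U. d u * y u) \<le> (\<Sum>u\<in>U. y u)"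
    using y0 UV by (intro sum_mono mult_left_le_one_le) (auto simp: not_le)
  moreover have "0 \<le> (\<Sum>w\<in>W. d w * (1 - y w))"
    using y1 WV by (intro sum_nonneg) auto
  moreover have "0 \<le> (\<Sum>w\<in>W. \<Sum>w'\<in>W. of_bool (adj w' w) :: real)"
    by (intro sum_nonneg) auto
  ultimately show False
    using key D_gt by linarith
qed

text \<open>With maximum degree 2, the nontrivial part of \<open>G[U]\<close> has at most five
  vertices, so the degree sum is at most 10, against \<open>D_gt\<close>.\<close>

lemma ex_d_ge_3: "\<exists>b\<in>U. d b \<ge> 3"
proof (rule ccontr)
  assume "\<not> (\<exists>b\<in>U. d b \<ge> 3)"
  then have d2: "d u \<le> 2" if "u \<in> U" for u
    using that by force
  obtain b where b: "b \<in> U" "d b = 2"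
    using ex_d_ge_2 d2 by force
  then obtain p q where pq: "{u\<in>U. adj u b} = {p, q}" "p \<noteq> q"
    unfolding d_def by (auto simp: card_2_iff)
  then have pqb: "p \<in> U" "q \<in> U" "adj p b" "adj q b"
    by blast+
  have ne: "p \<noteq> b" "q \<noteq> b"
    using pqb adj_irrefl by auto
  define N where "N v = {u\<in>U. adj u v} - {b}" for v
  have cN: "card (N v) \<le> 1" if "v \<in> U" "adj v b" for v
    using d2[OF that(1)] that b finU by (simp add: N_def d_def insert_commute)
  \<comment> \<open>An edge at a vertex outside this set would be disjoint from the path
    \<open>p b q\<close>.\<close>
  let ?T = "{b} \<union> {p, q} \<union> N p \<union> N q"
  have sup: "d u = 0" if "u \<in> U" "u \<notin> ?T" for u
  proof (rule ccontr)
    assume "d u \<noteq> 0"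
    then obtain v where v: "v \<in> U" "adj v u"
      by (auto simp: d_eq_0)
    have "v \<noteq> u"
      using v adj_irrefl by auto
    have "\<not> adj u b"
      using pq(1) that by auto
    then have "distinct [p, b, q, u, v]"
      using that v pq(2) ne \<open>v \<noteq> u\<close> by (auto simp: N_def insert_commute)
    then show False
      using no_path_edge[of p q u v b] pqb that v zU b by (auto simp: insert_commute)
  qed
  have T: "?T \<subseteq> U"
    using b pqb by (auto simp: N_def)
  then have fT: "finite ?T"
    using finU finite_subset by blast
  have "card ?T \<le> card ({b} \<union> {p, q}) + card (N p) + card (N q)"
    using card_Un_le[of "{b} \<union> {p, q} \<union> N p" "N q"] card_Un_le[of "{b} \<union> {p, q}" "N p"] by linarith
  also have "\<dots> \<le> 5"
    using cN[of p] cN[of q] pqb ne pq(2) by simp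
  finally have "card ?T \<le> 5" .
  have "(\<Sum>u\<in>U. d u) = (\<Sum>u\<in>?T. d u)"
    using sup T finU by (intro sum.mono_neutral_right) auto
  also have "\<dots> \<le> card ?T * 2"
    using sum_bounded_above[of ?T d 2] d2 T by fastforce
  finally show False
    using D_gt_nat \<open>card ?T \<le> 5\<close> by linarith
qed

text \<open>With maximum degree 3, all edges of \<open>G[U]\<close> lie on \<open>b\<close> and its
  three neighbours, and the degree sum forces a \<open>K_4\<close>. The vertices of a
  \<open>K_4\<close> then carry too little weight for \<open>key\<close>.\<close>

lemma ex_d_ge_4: "\<exists>b\<in>U. d b \<ge> 4"
proof (rule ccontr)
  assume "\<not> (\<exists>b\<in>U. d b \<ge> 4)"
  then have d3: "d u \<le> 3" if "u \<in> U" for u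
    using that by force
  obtain b where b: "b \<in> U" "d b = 3"
    using ex_d_ge_3 d3 by force
  then obtain p q r where pqr: "{u\<in>U. adj u b} = {p, q, r}" "distinct [p, q, r]"
    unfolding d_def by (auto simp: card_3_iff)
  then have pqrb: "p \<in> U" "q \<in> U" "r \<in> U" "adj p b" "adj q b" "adj r b"
    by blast+
  have ne: "b \<noteq> p" "b \<noteq> q" "b \<noteq> r"
    using pqrb adj_irrefl by auto
  define T where "T = {b, p, q, r}"
  have T: "T \<subseteq> U" "finite T" "card T = 4"
    using b pqrb pqr(2) ne by (auto simp: T_def)
  \<comment> \<open>An edge leaving \<open>T\<close> misses \<open>b\<close>, and at least two of
    \<open>p\<close>, \<open>q\<close>, \<open>r\<close> are off the edge; they form a path through
    \<open>b\<close>.\<close>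
  have nbT: "u \<in> T" if "u \<in> U" "v \<in> U" "adj u v" for u v
  proof (rule ccontr)
    assume u: "u \<notin> T"
    then have "v \<noteq> b" "u \<noteq> v"
      using that pqr(1) adj_irrefl by (auto simp: T_def)
    moreover have bz: "b \<noteq> z"
      using b zU by auto
    ultimately show False
      using no_path_edge[of p q u v b] no_path_edge[of p r u v b] no_path_edge[of q r u v b]
        that u pqrb pqr(2) ne by (auto simp: T_def)
  qed
  have sup: "d u = 0" if "u \<in> U" "u \<notin> T" for u
    using that nbT by (auto simp: d_eq_0 insert_commute)
  have sumT: "(\<Sum>u\<in>U. d u) = (\<Sum>u\<in>T. d u)"
    using sup T finU by (intro sum.mono_neutral_right) auto
  \<comment> \<open>A missing edge would reduce the degree sum to at most
    \<open>2 + 2 + 3 + 3 = 10\<close>.\<close>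
  have K4: "adj u v" if uv: "u \<in> T" "v \<in> T" "u \<noteq> v" for u v
  proof (rule ccontr)
    assume na: "\<not> adj u v"
    have "{w\<in>U. adj w u} \<subseteq> T - {u, v}" "{w\<in>U. adj w v} \<subseteq> T - {u, v}"
      using nbT uv T na adj_irrefl by (auto simp: insert_commute)
    moreover have "card (T - {u, v}) = 2"
      using uv T by (simp add: card_Diff_subset)
    ultimately have d2: "d u \<le> 2" "d v \<le> 2"
      unfolding d_def using T(2) by (metis card_mono finite_Diff)+
    have "(\<Sum>t\<in>T - {u, v}. d t) \<le> card (T - {u, v}) * 3"
      using sum_bounded_above[of "T - {u, v}" d 3] d3 T by auto
    moreover have "(\<Sum>t\<in>T. d t) = d u + (d v + (\<Sum>t\<in>T - {u, v}. d t))"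
      using uv T(2) by (simp add: sum.remove[of T u] sum.remove[of "T - {u}" v] Diff_insert2[symmetric] insert_commute)
    ultimately show False
      using d2 D_gt_nat sumT \<open>card (T - {u, v}) = 2\<close> by simp
  qed
  have nb: "{u\<in>U. adj u t} = T - {t}" if "t \<in> T" for t
    using nbT K4 T that adj_irrefl by auto
  have dT: "d t = 3" if "t \<in> T" for t
    unfolding d_def nb[OF that] using that T by simp
  let ?S = "\<Sum>t\<in>T. y t"
  let ?X = "\<Sum>w\<in>W. d w * (1 - y w)"
  let ?DW = "\<Sum>w\<in>W. \<Sum>w'\<in>W. of_bool (adj w' w) :: real"
  have "(\<Sum>u\<in>U. d u * y u) = 3 * ?S"
    using D_support[OF T(1) sup, of y] dT by (simp add: sum_distrib_left)
  moreover have "(\<Sum>u\<in>U. real (d u)) = 12"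
    using D_support[OF T(1) sup, of "\<lambda>_. 1"] dT T by simp
  ultimately have k: "3 * ?S - (\<Sum>u\<in>U. y u) + 3/2 > 6 + ?DW / 2 + ?X"
    using key by simp
  have S4: "?S \<le> 4"
    using sum_bounded_above[of T y 1] y1 T UV by (auto simp: subset_iff)
  have DW: "?DW \<ge> 0"
    by (intro sum_nonneg) auto
  have X: "?X \<ge> 0"
    using y1 WV by (intro sum_nonneg) auto
  \<comment> \<open>In \<open>k\<close> the left side is below \<open>12 - 13/2 + 3/2 = 7\<close>,
    so \<open>?DW / 2 + ?X < 1\<close>.\<close>
  have "?DW < 2"
    using k S4 X mu mu_le by linarith
  then have Wi: "\<not> adj w w'" if "w \<in> W" "w' \<in> W" for w w'
    using W_indep that by blast
  have d1: "d w \<le> 1" if "w \<in> W" for w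
  proof (rule ccontr)
    assume "\<not> d w \<le> 1"
    then obtain i j where ij: "i \<noteq> j" "i \<in> {u\<in>U. adj u w}" "j \<in> {u\<in>U. adj u w}"
      unfolding d_def using finU by (auto simp: card_le_Suc0_iff_eq)
    have "2 \<le> card (T - {i, j})"
      using diff_card_le_card_Diff[of "{i, j}" T] T ij(1) by simp
    then obtain s t where st: "s \<in> T - {i, j}" "t \<in> T - {i, j}" "s \<noteq> t"
      by (rule two_le_cardE)
    moreover have "w \<noteq> z" "w \<notin> U"
      using that by (auto simp: W_def)
    ultimately show False
      using no_path_edge[of i j s t w] ij K4[of s t] T(1) by (auto simp: subset_iff)
  qed
  have yw: "y w \<le> 2/13" if "w \<in> W" for w
  proof -
    have "\<mu> * y w \<le> 1"
      using W_y[OF Wi that] d1[OF that] by linarith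
    moreover have "13/2 * y w \<le> \<mu> * y w"
      using mu y0[of w] that WV by (intro mult_right_mono) auto
    ultimately show ?thesis by linarith
  qed
  \<comment> \<open>The factor is \<open>1 - 2/13\<close>. With \<open>?X < 1\<close> it limits the
    edges between \<open>U\<close> and \<open>W\<close>.\<close>
  have "(\<Sum>w\<in>W. d w * (11/13::real)) \<le> ?X"
    using yw by (intro sum_mono mult_left_mono) (auto simp: field_simps)
  then have "(\<Sum>w\<in>W. real (d w)) * (11/13) \<le> ?X"
    by (simp only: sum_distrib_right)
  then have dW: "(\<Sum>w\<in>W. real (d w)) \<le> 13/11"
    using k S4 DW mu mu_le by linarith
  \<comment> \<open>Summing \<open>sub\<close> over \<open>T\<close> bounds \<open>7/2 * ?S\<close>
    by \<open>4 + 13/11\<close>, whereas \<open>k\<close> requires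
    \<open>3 * ?S > 11\<close>.\<close>
  have "\<mu> * ?S \<le> (\<Sum>t\<in>T. \<Sum>u\<in>V. of_bool (adj u t) * y u)"
    unfolding sum_distrib_left using UV T by (intro sum_mono sub) auto
  also have "\<dots> = (\<Sum>t\<in>T. of_bool (adj z t)) + (\<Sum>t\<in>T. \<Sum>u\<in>U. of_bool (adj u t) * y u)
      + (\<Sum>t\<in>T. \<Sum>w\<in>W. of_bool (adj w t) * y w)"
    by (simp add: sum_V sum.distrib yz)
  also have "(\<Sum>t\<in>T. of_bool (adj z t)) \<le> (4::real)"
    using sum_bounded_above[of T "\<lambda>t. of_bool (adj z t) :: real" 1] T by auto
  also have "(\<Sum>t\<in>T. \<Sum>u\<in>U. of_bool (adj u t) * y u) = (\<Sum>t\<in>T. ?S - y t)"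
  proof (intro sum.cong refl)
    fix t assume t: "t \<in> T"
    have "(\<Sum>u\<in>U. of_bool (adj u t) * y u) = (\<Sum>u\<in>{u\<in>U. adj u t}. y u)"
      using finU by (intro sum.mono_neutral_cong_right) auto
    then show "(\<Sum>u\<in>U. of_bool (adj u t) * y u) = ?S - y t"
      using nb[OF t] T t by (simp add: sum_diff1)
  qed
  also have "(\<Sum>t\<in>T. ?S - y t) = 3 * ?S"
    using T by (simp add: sum_subtractf)
  also have "(\<Sum>t\<in>T. \<Sum>w\<in>W. of_bool (adj w t) * y w) \<le> (\<Sum>t\<in>U. \<Sum>w\<in>W. of_bool (adj w t) * y w)"
    using T finU y0 WV by (intro sum_mono2 sum_nonneg) auto
  also have "\<dots> = (\<Sum>w\<in>W. d w * y w)"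
    by (rule d_W)
  also have "\<dots> \<le> (\<Sum>w\<in>W. real (d w))"
    using y1 WV by (intro sum_mono mult_left_le) auto
  finally have "\<mu> * ?S \<le> 4 + 3 * ?S + 13/11"
    using dW by simp
  moreover have "13/2 * ?S \<le> \<mu> * ?S"
    using mu y0 T UV by (intro mult_right_mono sum_nonneg) auto
  ultimately show False
    using k X DW mu mu_le by linarith
qed

text \<open>A vertex \<open>c\<close> with four neighbours in \<open>U\<close> keeps two of them off
  any edge avoiding \<open>c\<close>, so every edge of \<open>G[U]\<close> meets \<open>c\<close>.
  What \<open>key\<close> then leaves over is too small for even one vertex of
  \<open>W\<close>.\<close>

lemma star:
  obtains c where "c \<in> U" "(\<Sum>u\<in>U. real (d u)) = 2 * d c" "W = {}" "\<And>u v. u \<in> U \<Longrightarrow> v \<in> U \<Longrightarrow> adj u v \<Longrightarrow> c = u \<or> c = v"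
proof -
  obtain c where c: "c \<in> U" "d c \<ge> 4"
    using ex_d_ge_4 by blast
  define L where "L = {u\<in>U. adj u c}"
  have L: "finite L" "card L = d c" "L \<subseteq> U" "c \<notin> L"
    using finU adj_irrefl[of c] by (auto simp: L_def d_def)
  have cz: "c \<noteq> z"
    using c zU by auto
  have cov: "c = u \<or> c = v" if uv: "u \<in> U" "v \<in> U" "adj u v" for u v
  proof (rule ccontr)
    assume nc: "\<not> (c = u \<or> c = v)"
    have "u \<noteq> v"
      using uv adj_irrefl by auto
    have "2 \<le> card (L - {u, v})"
      using diff_card_le_card_Diff[of "{u, v}" L] L c card_insert_le_m1[of 2 "{v}" u] by simp
    then obtain s t where st: "s \<in> L - {u, v}" "t \<in> L - {u, v}" "s \<noteq> t"
      by (rule two_le_cardE)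
    moreover have "s \<noteq> c" "t \<noteq> c"
      using st L(4) by auto
    ultimately show False
      using no_path_edge[of s t u v c] uv nc cz L \<open>u \<noteq> v\<close> by (auto simp: L_def)
  qed
  have d1: "d u = 1" if "u \<in> L" for u
  proof -
    have "u \<noteq> c"
      using that L(4) by auto
    have "{v\<in>U. adj v u} = {c}"
    proof (intro equalityI subsetI)
      fix v assume "v \<in> {v\<in>U. adj v u}"
      then show "v \<in> {c}"
        using cov[of v u] that L(3) \<open>u \<noteq> c\<close> by blast
    next
      fix v assume "v \<in> {c}"
      then show "v \<in> {v\<in>U. adj v u}"
        using that c adj_commute[of u c] by (simp add: L_def)
    qed
    then show ?thesis by (simp add: d_def)
  qed
  have sup: "d u = 0" if "u \<in> U" "u \<notin> insert c L" for u
    using that cov[of _ u] by (auto simp: d_eq_0 L_def insert_commute)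
  have cL: "insert c L \<subseteq> U"
    using c L by auto
  let ?X = "\<Sum>w\<in>W. d w * (1 - y w)"
  let ?DW = "\<Sum>w\<in>W. \<Sum>w'\<in>W. of_bool (adj w' w) :: real"
  have "(\<Sum>u\<in>U. d u * y u) = d c * y c + (\<Sum>u\<in>L. y u)"
    using D_support[OF cL sup, of y] d1 L by simp
  moreover have D: "(\<Sum>u\<in>U. real (d u)) = 2 * d c"
    using D_support[OF cL sup, of "\<lambda>_. 1"] d1 L by simp
  moreover have "y c + (\<Sum>u\<in>L. y u) \<le> (\<Sum>u\<in>U. y u)"
    using sum_mono2[OF finU cL, of y] y0 UV L by auto
  moreover have "(real (d c) - 1) * y c \<le> real (d c) - 1"
    using y1[of c] c UV by (intro mult_left_le) auto
  \<comment> \<open>Half the degree sum is \<open>d c\<close>, while the weighted gain is at most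
    \<open>d c - 1\<close>; of the \<open>3/2\<close> only \<open>1/2\<close> remains.\<close>
  ultimately have k: "1/2 > ?DW / 2 + ?X"
    using key by (simp add: algebra_simps)
  have DW: "?DW \<ge> 0"
    by (intro sum_nonneg) auto
  have X: "?X \<ge> 0"
    using y1 WV by (intro sum_nonneg) auto
  have "?DW < 2"
    using k X by linarith
  then have Wi: "\<not> adj w w'" if "w \<in> W" "w' \<in> W" for w w'
    using W_indep that by blast
  have False if w: "w \<in> W" for w
  proof -
    have wn: "w \<noteq> z" "w \<notin> U" "w \<in> V"
      using w by (auto simp: W_def)
    \<comment> \<open>Two neighbours of \<open>w\<close> other than \<open>c\<close> give a path
      through \<open>w\<close>, disjoint from some edge of the star.\<close>
    have "card ({u\<in>U. adj u w} - {c}) \<le> 1"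
    proof (rule ccontr)
      assume "\<not> card ({u\<in>U. adj u w} - {c}) \<le> 1"
      then obtain i j where ij: "i \<noteq> j" "i \<in> {u\<in>U. adj u w} - {c}" "j \<in> {u\<in>U. adj u w} - {c}"
        using finU by (auto simp: card_le_Suc0_iff_eq)
      have "2 \<le> card (L - {i, j})"
        using diff_card_le_card_Diff[of "{i, j}" L] L c ij(1) by simp
      then obtain s where "s \<in> L - {i, j}"
        by (rule two_le_cardE)
      moreover from this have "s \<noteq> c"
        using L(4) by auto
      moreover have "i \<noteq> w" "j \<noteq> w" "s \<noteq> w" "c \<noteq> w"
        using ij wn(2) c(1) calculation(1) by (auto simp: L_def)
      ultimately show False
        using no_path_edge[of i j s c w] ij wn c by (auto simp: L_def)
    qed
    then have d2: "d w \<le> 2"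
      by (simp add: d_def card_Diff_singleton_if split: if_splits)
    obtain e where e: "e \<in> E" "w \<in> e"
      using noiso wn by (auto simp: no_isolated_def)
    moreover have "card e = 2"
      using graph e by (simp add: simple_graph_def)
    ultimately obtain v where v: "adj v w"
      using adj_commute by (metis card_2_iff insertE singletonD)
    have "v \<noteq> z"
      using W_z[OF w] v adj_commute by blast
    then have "v \<in> U"
      using Wi[of v w] w v adj_V[OF v] by (auto simp: W_def)
    then have "d w \<noteq> 0"
      using v by (auto simp: d_eq_0)
    have "13/2 * y w \<le> \<mu> * y w"
      using mu y0[of w] wn by (intro mult_right_mono) auto
    then have "y w \<le> 4/13"
      using W_y[OF Wi w] d2 by linarith
    \<comment> \<open>As \<open>w\<close> is not isolated and has no neighbour in \<open>W\<close>,
      \<open>d w \<ge> 1\<close>; the resulting loss of \<open>9/13\<close> exceeds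
      \<open>1/2\<close>.\<close>
    then have "1 * (9/13) \<le> d w * (1 - y w)"
      using \<open>d w \<noteq> 0\<close> by (intro mult_mono) auto
    also have "\<dots> \<le> ?X"
      using finW w y1 WV by (intro member_le_sum) auto
    finally show False
      using k DW by linarith
  qed
  then have "W = {}" by blast
  with c D cov show ?thesis
    using that by blast
qed

end

section \<open>Comparison with the extremal graph\<close>

lemma S2minus_E_iff:
  assumes "i < n" "j < n"
  shows "{i, j} \<in> S2minus_E n \<longleftrightarrow>
    i = 0 \<and> 1 \<le> j \<or> j = 0 \<and> 1 \<le> i \<or> i = 1 \<and> 3 \<le> j \<or> j = 1 \<and> 3 \<le> i"
  using assms unfolding S2minus_E_def S2_E_def by (auto simp: doubleton_eq_iff)

text \<open>Applied to the spectral radius, the first conclusion yields the upper bound and the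
  second the equality case. The absolute values fix the structure of the graph; the signed
  eigenvector then gives exact equations.\<close>

lemma large_eigenvalue_imp_S2minus:
  assumes graph: "simple_graph V E" and m: "card E = m" "even m" "m \<ge> 38"
    and noiso: "no_isolated V E" and H43: "\<not> contains_H43 V E"
    and ev: "adj_eigenvalue V E \<mu>" and ge: "\<mu> \<ge> rho' m"
  shows "quartic m \<mu> = 0 \<and> graph_iso V E {0..<(m + 4) div 2} (S2minus_E ((m + 4) div 2))"
proof -
  have finV: "finite V"
    using graph by (simp add: simple_graph_def)
  obtain x where x: "\<exists>v\<in>V. x v \<noteq> 0"
    "\<And>v. v \<in> V \<Longrightarrow> (\<Sum>u\<in>V. if {u, v} \<in> E then x u else 0) = \<mu> * x v"
    using ev unfolding adj_eigenvalue_def by blast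
  have "Max ((\<lambda>v. \<bar>x v\<bar>) ` V) \<in> (\<lambda>v. \<bar>x v\<bar>) ` V"
    using finV x(1) by (intro Max_in) auto
  then obtain z where z: "z \<in> V" "\<bar>x z\<bar> = Max ((\<lambda>v. \<bar>x v\<bar>) ` V)"
    by auto
  then have zmax: "\<bar>x v\<bar> \<le> \<bar>x z\<bar>" if "v \<in> V" for v
    using finV that by simp
  have xz: "x z \<noteq> 0"
    using x(1) zmax by force
  note mu' = rho'_lower[OF m(3) ge]
  interpret H43_free_subeigenvector V E \<mu> "\<lambda>v. \<bar>x v\<bar> / \<bar>x z\<bar>" z
  proof
    fix v assume v: "v \<in> V"
    have "\<mu> * \<bar>x v\<bar> = \<bar>\<Sum>u\<in>V. if {u, v} \<in> E then x u else 0\<bar>"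
      using x(2)[OF v] mu' by (simp add: abs_mult)
    also have "\<dots> \<le> (\<Sum>u\<in>V. \<bar>if {u, v} \<in> E then x u else 0\<bar>)"
      by (rule sum_abs)
    also have "\<dots> = (\<Sum>u\<in>V. of_bool ({u, v} \<in> E) * \<bar>x u\<bar>)"
      by (intro sum.cong) auto
    finally show "\<mu> * (\<bar>x v\<bar> / \<bar>x z\<bar>) \<le> (\<Sum>u\<in>V. of_bool ({u, v} \<in> E) * (\<bar>x u\<bar> / \<bar>x z\<bar>))"
      using xz by (simp add: divide_right_mono flip: sum_divide_distrib)
  qed (use graph z(1) zmax xz mu' m noiso H43 in auto)
  obtain c where c: "c \<in> U" and D: "(\<Sum>u\<in>U. real (d u)) = 2 * d c" and W: "W = {}"
    and cov: "\<And>u v. u \<in> U \<Longrightarrow> v \<in> U \<Longrightarrow> adj u v \<Longrightarrow> c = u \<or> c = v"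
    using star by blast
  define L where "L = {u\<in>U. adj u c}"
  \<comment> \<open>These vertices are isolated in \<open>G[U]\<close>, so \<open>z\<close> is their
    only neighbour.\<close>
  define P where "P = U - L - {c}"
  have LP: "finite L" "finite P" "L \<inter> P = {}" "c \<notin> L" "c \<notin> P" "z \<notin> L" "z \<notin> P" "c \<noteq> z" "card L = d c"
    using finU zU c adj_irrefl[of c] by (auto simp: L_def P_def d_def)
  have U: "U = insert c (L \<union> P)" and V: "V = insert z U"
    using c W UV z by (auto simp: L_def P_def W_def)
  have adj_z: "adj u z \<longleftrightarrow> u \<in> U" for u
    using adj_V by (auto simp: U_def)
  have adj_U: "adj u v \<longleftrightarrow> u = c \<and> v \<in> L \<or> v = c \<and> u \<in> L" if "u \<in> U" "v \<in> U" for u v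
    using cov[OF that] that by (auto simp: L_def insert_commute)
  have sumU: "(\<Sum>u\<in>U. f u) = f c + sum f L + sum f P" for f :: "'a \<Rightarrow> real"
    unfolding U using LP by (simp add: sum.union_disjoint)
  define r where "r = card L"
  define t where "t = card P"
  have "card U = 1 + r + t"
    using arg_cong[OF U, of card] LP by (simp add: card_Un_disjoint r_def t_def)
  \<comment> \<open>There are \<open>1 + r + t\<close> edges at \<open>z\<close> and
    \<open>r\<close> further edges in the star.\<close>
  then have "real m = real (2 * r + t + 1)"
    using edge_count D W LP(9) m(1) by (simp add: r_def)
  then have mrt: "m = 2 * r + t + 1"
    by (simp only: of_nat_eq_iff)
  have eig: "\<mu> * x v = of_bool (adj z v) * x z + of_bool (adj c v) * x c
      + (\<Sum>u\<in>L. of_bool (adj u v) * x u) + (\<Sum>u\<in>P. of_bool (adj u v) * x u)" if "v \<in> V" for v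
  proof -
    have "\<mu> * x v = (\<Sum>u\<in>V. of_bool (adj u v) * x u)"
      unfolding x(2)[OF that, symmetric] by (intro sum.cong) auto
    then show ?thesis
      by (simp add: sum_V W sumU)
  qed
  \<comment> \<open>The cells \<open>{z}\<close>, \<open>{c}\<close>, \<open>L\<close> and
    \<open>P\<close> form an equitable partition. Summing the eigenvalue equations over the cells
    and eliminating \<open>?SL\<close> and \<open>?SP\<close> leaves two equations in
    \<open>?A\<close> and \<open>?C\<close>.\<close>
  let ?A = "x z" and ?C = "x c" and ?SL = "\<Sum>u\<in>L. x u" and ?SP = "\<Sum>u\<in>P. x u"
  have inU: "c \<in> U" "\<And>u. u \<in> L \<Longrightarrow> u \<in> U" "\<And>u. u \<in> P \<Longrightarrow> u \<in> U"
    using U by auto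
  have adj_z': "adj z u \<longleftrightarrow> u \<in> U" for u
    using adj_z[of u] by (simp add: insert_commute)
  have 1: "\<mu> * ?A = ?C + ?SL + ?SP"
    using eig[of z] z zU inU adj_irrefl[of z] by (simp add: adj_z)
  have nL: "u \<notin> P" "u \<noteq> c" if "u \<in> L" for u
    using that LP by auto
  have nP: "u \<notin> L" "u \<noteq> c" if "u \<in> P" for u
    using that LP by auto
  have 2: "\<mu> * ?C = ?A + ?SL"
    using eig[of c] c UV inU nL nP LP adj_irrefl[of c] by (simp add: adj_z' adj_U subset_iff)
  have "\<mu> * x v = ?A + ?C" if "v \<in> L" for v
    using eig[of v] that UV inU nL nP LP by (simp add: adj_z' adj_U subset_iff)
  then have 3: "\<mu> * ?SL = r * (?A + ?C)"
    by (simp add: sum_distrib_left r_def)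
  have "\<mu> * x v = ?A" if "v \<in> P" for v
    using eig[of v] that UV inU nL nP LP by (simp add: adj_z' adj_U subset_iff)
  then have 4: "\<mu> * ?SP = t * ?A"
    by (simp add: sum_distrib_left t_def)
  have 5: "(\<mu>\<^sup>2 - r - t) * ?A = (\<mu> + r) * ?C"
  proof -
    have "\<mu> * (\<mu> * ?A) = \<mu> * ?C + \<mu> * ?SL + \<mu> * ?SP"
      unfolding 1 by (simp add: algebra_simps)
    then show ?thesis
      unfolding 3 4 by (simp add: algebra_simps power2_eq_square)
  qed
  have 6: "(\<mu>\<^sup>2 - r) * ?C = (\<mu> + r) * ?A"
  proof -
    have "\<mu> * (\<mu> * ?C) = \<mu> * ?A + \<mu> * ?SL"
      unfolding 2 by (simp add: algebra_simps)
    then show ?thesis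
      unfolding 3 by (simp add: algebra_simps power2_eq_square)
  qed
  have "(\<mu>\<^sup>2 - r) * ((\<mu>\<^sup>2 - r - t) * ?A) = (\<mu> + r) * ((\<mu>\<^sup>2 - r) * ?C)"
    unfolding 5 by simp
  then have "((\<mu>\<^sup>2 - r) * (\<mu>\<^sup>2 - r - t) - (\<mu> + r)\<^sup>2) * ?A = 0"
    unfolding 6 by (simp add: algebra_simps power2_eq_square)
  then have 7: "(\<mu>\<^sup>2 - r) * (\<mu>\<^sup>2 - r - t) - (\<mu> + r)\<^sup>2 = 0"
    using xz by simp
  \<comment> \<open>The bracket vanishes by \<open>7\<close>, and it agrees with the quartic exactly
    when the correction term does vanish, in particular for \<open>t = 1\<close>.\<close>
  have "quartic m \<mu> = ((\<mu>\<^sup>2 - r) * (\<mu>\<^sup>2 - r - t) - (\<mu> + r)\<^sup>2) + (real t - 1) * (1/2 - r - \<mu>)"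
    by (simp add: quartic_def mrt field_simps power2_eq_square power4_eq_xxxx)
  then have q: "quartic m \<mu> = (real t - 1) * (1/2 - r - \<mu>)"
    unfolding 7 by simp
  then have "0 \<le> (real t - 1) * (1/2 - r - \<mu>)"
    using rho'_root(2)[OF _ ge] m by simp
  then have "t \<le> 1"
    using mu'(1) by (auto simp: zero_le_mult_iff)
  \<comment> \<open>Since \<open>m = 2 * r + t + 1\<close> is even, \<open>t\<close> is odd.\<close>
  then have t: "t = 1"
    using mrt m(2) by (cases t) auto
  then obtain p where p: "P = {p}"
    by (auto simp: t_def card_1_singleton_iff)
  define n where "n = (m + 4) div 2"
  have n: "n = r + 3"
    using mrt t by (simp add: n_def)
  have "card L = card {3..<n}"
    by (simp add: n r_def)
  then obtain h where h: "bij_betw h L {3..<n}"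
    using finite_same_card_bij[OF LP(1) finite_atLeastLessThan] by blast
  \<comment> \<open>\<open>z\<close> dominates the graph and becomes 0, the star centre becomes 1,
    and the pendant vertex \<open>p\<close> becomes 2, the vertex that lost its edge to 1.\<close>
  define f where "f v = (if v = z then 0 else if v = c then 1 else if v = p then 2 else h v)" for v
  have ne: "c \<noteq> z" "p \<noteq> z" "p \<noteq> c" "p \<notin> L"
    using LP p by auto
  have fs: "f z = 0" "f c = 1" "f p = 2"
    using ne by (auto simp: f_def)
  have fL: "f v = h v" if "v \<in> L" for v
    using that ne LP by (auto simp: f_def)
  have fL3: "3 \<le> f v" "f v < n" if "v \<in> L" for v
    using that h fL by (auto simp: bij_betw_def)
  have VL: "V = {z, c, p} \<union> L"
    using V U p by auto
  have "bij_betw f V {0..<n}"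
  proof -
    have "bij_betw f L {3..<n}"
      using h fL by (simp cong: bij_betw_cong)
    moreover have "bij_betw f {z, c, p} {0, 1, 2}"
      using ne by (auto simp: bij_betw_def fs)
    ultimately have "bij_betw f ({z, c, p} \<union> L) ({0, 1, 2} \<union> {3..<n})"
      by (intro bij_betw_combine) auto
    moreover have "{0, 1, 2} \<union> {3..<n} = {0..<n}"
      using n by auto
    ultimately show ?thesis
      unfolding VL by simp
  qed
  moreover have "adj u v \<longleftrightarrow> {f u, f v} \<in> S2minus_E n" if "u \<in> V" "v \<in> V" for u v
  proof -
    have V_cases: "w = z \<or> w = c \<or> w = p \<or> w \<in> L" if "w \<in> V" for w
      using that VL by blast
    have fn: "f w < n" if "w \<in> V" for w
      using V_cases[OF that] by (elim disjE) (use fs fL3(2)[of w] n in simp_all)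
    have pU: "p \<in> U"
      using inU(3) p by simp
    have f1: "1 \<le> f w \<longleftrightarrow> w \<in> U" if "w \<in> V" for w
      using V_cases[OF that]
      by (elim disjE) (use zU fs pU c inU(2)[of w] fL3(1)[of w] in auto)
    consider "u = z" | "v = z" | "u \<in> U" "v \<in> U"
      using \<open>u \<in> V\<close> \<open>v \<in> V\<close> equalityD1[OF V] by blast
    then have "adj u v \<longleftrightarrow> f u = 0 \<and> 1 \<le> f v \<or> f v = 0 \<and> 1 \<le> f u \<or> f u = 1 \<and> 3 \<le> f v \<or> f v = 1 \<and> 3 \<le> f u"
    proof cases
      case 1
      then show ?thesis
        using f1[OF that(2)] fs adj_z'[of v] by auto
    next
      case 2
      then show ?thesis
        using f1[OF that(1)] fs adj_z[of u] by auto
    next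
      case 3
      \<comment> \<open>On \<open>U\<close> the labels detect the centre and the leaves, which by
        \<open>adj_U\<close> decide adjacency.\<close>
      have w: "f w \<ge> 1 \<and> (f w = 1 \<longleftrightarrow> w = c) \<and> (3 \<le> f w \<longleftrightarrow> w \<in> L)" if "w \<in> U" for w
      proof -
        have "w = c \<or> w = p \<or> w \<in> L"
          using that U p by blast
        then show ?thesis
          by (elim disjE) (use fs fL3(1)[of w] LP(4) ne in auto)
      qed
      show ?thesis
        using w[OF 3(1)] w[OF 3(2)] adj_U[OF 3] by auto
    qed
    then show ?thesis
      using S2minus_E_iff[OF fn fn, OF that] by simp
  qed
  ultimately have "graph_iso V E {0..<n} (S2minus_E n)"
    unfolding graph_iso_def by blast
  then show ?thesis
    using q t by (simp add: n_def)
qed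

text \<open>An explicit eigenvector is pulled back along the isomorphism. Exhibiting this one
  eigenvalue suffices, as the spectral radius is a maximum.\<close>

lemma S2minus_eigenvalue:
  assumes m: "even m" "m \<ge> 38" and iso: "graph_iso V E {0..<(m + 4) div 2} (S2minus_E ((m + 4) div 2))"
  shows "adj_eigenvalue V E (rho' m)"
proof -
  define n where "n = (m + 4) div 2"
  define k where "k = n - 3"
  have mk: "m = 2 * k + 2" and n: "n = k + 3"
    using m by (auto simp: n_def k_def elim!: evenE)
  obtain f where f: "bij_betw f V {0..<n}"
    and fE: "\<And>u v. u \<in> V \<Longrightarrow> v \<in> V \<Longrightarrow> {u, v} \<in> E \<longleftrightarrow> {f u, f v} \<in> S2minus_E n"
    using iso unfolding graph_iso_def n_def by blast
  define \<rho> where "\<rho> = rho' m"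
  have rho: "\<rho> > 0"
    using rho'_lower(1)[OF m(2) order_refl] by (simp add: \<rho>_def)
  \<comment> \<open>\<open>A\<close> and \<open>C\<close> are chosen so that
    \<open>(\<rho>\<^sup>2 - k) * C = (\<rho> + k) * A\<close>, the equation at vertex 1 after
    eliminating \<open>B\<close>. The values \<open>A / \<rho>\<close> and \<open>B\<close> solve
    the rows of vertex 2 and of the vertices from 3 on.\<close>
  define A where "A = \<rho>\<^sup>2 - k"
  define C where "C = \<rho> + k"
  define B where "B = (A + C) / \<rho>"
  define g where "g i = (if i = 0 then A else if i = 1 then C else if i = 2 then A / \<rho> else B)" for i :: nat
  have "quartic m \<rho> = 0"
    using rho'_root(1) m by (simp add: \<rho>_def)
  \<comment> \<open>\<open>AC\<close> is row 0 times \<open>\<rho>\<close> and uses the quartic;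
    \<open>CA\<close> is row 1 times \<open>\<rho>\<close> and is a polynomial identity.\<close>
  then have AC: "\<rho>\<^sup>2 * A = \<rho> * C + A + k * (A + C)"
    by (simp add: A_def C_def quartic_def mk field_simps power2_eq_square power4_eq_xxxx)
  have CA: "\<rho>\<^sup>2 * C = \<rho> * A + k * (A + C)"
    by (simp add: A_def C_def algebra_simps power2_eq_square)
  have gev: "(\<Sum>j\<in>{0..<n}. if {j, i} \<in> S2minus_E n then g j else 0) = \<rho> * g i" if i: "i < n" for i
  proof -
    let ?F = "\<lambda>j. if {j, i} \<in> S2minus_E n then g j else 0"
    have "{0..<n} = insert 0 (insert 1 (insert 2 {3..<n}))"
      using n by auto
    then have "(\<Sum>j\<in>{0..<n}. ?F j) = ?F 0 + ?F 1 + ?F 2 + (\<Sum>j\<in>{3..<n}. ?F j)"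
      by simp
    also have "(\<Sum>j\<in>{3..<n}. ?F j) = (\<Sum>j\<in>{3..<n}. if i \<le> 1 then B else 0)"
      using i by (intro sum.cong refl) (auto simp: S2minus_E_iff g_def)
    also have "\<dots> = (if i \<le> 1 then k * B else 0)"
      by (simp add: k_def)
    also have "?F 0 + ?F 1 + ?F 2 + \<dots> = \<rho> * g i"
    proof -
      consider "i = 0" | "i = 1" | "i = 2" | "i \<ge> 3" by linarith
      moreover have "{i} \<notin> S2minus_E n"
        using S2minus_E_iff[OF i i] by auto
      ultimately show ?thesis
        using AC CA rho i n
        by cases (auto simp: S2minus_E_iff g_def B_def field_simps power2_eq_square)
    qed
    finally show ?thesis .
  qed
  define x where "x v = (if v \<in> V then g (f v) else 0)" for v
  have fV: "f v < n" if "v \<in> V" for v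
    using f that by (auto simp: bij_betw_def)
  have "(\<Sum>u\<in>V. if {u, v} \<in> E then x u else 0) = \<rho> * x v" if v: "v \<in> V" for v
  proof -
    have "(\<Sum>u\<in>V. if {u, v} \<in> E then x u else 0) = (\<Sum>u\<in>V. if {f u, f v} \<in> S2minus_E n then g (f u) else 0)"
      using fE v by (intro sum.cong) (auto simp: x_def)
    also have "\<dots> = (\<Sum>j\<in>{0..<n}. if {j, f v} \<in> S2minus_E n then g j else 0)"
      by (rule sum.reindex_bij_betw[OF f])
    finally show ?thesis
      using gev[OF fV[OF v]] v by (simp add: x_def)
  qed
  moreover have "\<exists>v\<in>V. x v \<noteq> 0"
  proof -
    have "1 \<in> f ` V"
      using f n by (auto simp: bij_betw_def)
    then obtain v where "v \<in> V" "f v = 1"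
      by auto
    then have "x v > 0"
      using rho by (simp add: x_def g_def C_def)
    then show ?thesis
      using \<open>v \<in> V\<close> by force
  qed
  moreover have "x v = 0" if "v \<notin> V" for v
    using that by (simp add: x_def)
  ultimately show ?thesis
    unfolding adj_eigenvalue_def \<rho>_def by blast
qed

section \<open>The upper bound and the case of equality\<close>

theorem theorem1:
  fixes V :: "'a set" and E :: "'a set set" and m :: nat
  assumes "simple_graph V E"
    and "card E = m"
    and "even m" and "m \<ge> 38"
    and "no_isolated V E"
    and "\<not> contains_H43 V E"
  shows "spectral_radius V E \<le> rho' m \<and>
         (spectral_radius V E = rho' m \<longleftrightarrow>
            graph_iso V E {0..<(m + 4) div 2} (S2minus_E ((m + 4) div 2)))"
proof -
  let ?S = "{\<mu>. adj_eigenvalue V E \<mu>}"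
  have "E \<noteq> {}"
    using assms by auto
  then have "finite V" "V \<noteq> {}"
    using assms(1) by (auto simp: simple_graph_def)
  note S = adj_eigenvalues[OF this, of E]
  have Max: "adj_eigenvalue V E (spectral_radius V E)"
    using Max_in[OF S] by (simp add: spectral_radius_def)
  note large = large_eigenvalue_imp_S2minus[OF assms]
  \<comment> \<open>Above \<open>rho' m\<close> the spectral radius would itself be a root of the
    quartic, larger than the largest one.\<close>
  have le: "spectral_radius V E \<le> rho' m"
  proof (rule ccontr)
    assume "\<not> spectral_radius V E \<le> rho' m"
    then show False
      using large[OF Max] rho'_root(4)[of m] assms(4) by auto
  qed
  moreover have "rho' m \<le> spectral_radius V E"
    if "graph_iso V E {0..<(m + 4) div 2} (S2minus_E ((m + 4) div 2))"
    using S2minus_eigenvalue[OF assms(3,4) that] Max_ge[OF S(1)] by (simp add: spectral_radius_def)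
  ultimately show ?thesis
    using large[OF Max] by force
qed

end
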